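(* There is an absolute constant $c>0$ such that for every integer $N\ge 4$ there exists a function class $\mathcal{F}_N\subseteq(\{1,\dots,N\}\to\{1,-1\})$, containing the constant function $1$, such that $\mathsf{Edim}_1(\mathcal{F}_N)=4$ and $$\mathsf{sign}\text{-}\mathsf{rk}(\mathcal{F}_N)\ \ge\ c\,\frac{N^{1/9}}{\log N}.$$ Here the subscript $1$ denotes the constant function with value $1$.
   Context: For $\mathcal{F}\subseteq(\mathcal{X}\to\{1,-1\})$ and $f^\star\in\mathcal{F}$, the combinatorial eluder dimension $\mathsf{Edim}_{f^\star}(\mathcal{F})$ is the largest $m$ such that there exist $(x_1,f_1),\dots,(x_m,f_m)\in\mathcal{X}\times\mathcal{F}$ with, for all $i\in\{1,\dots,m\}$, $f_i(x_i)\ne f^\star(x_i)$ and $f_i(x_j)=f^\star(x_j)$ for all $j<i$. The sign-rank $\mathsf{sign}\text{-}\mathsf{rk}(\mathcal{F})$ is the smallest $d$ for which there exist maps $\phi:\mathcal{X}\to\mathbb{R}^d$ and $w:\mathcal{F}\to\mathbb{R}^d$, bounded in Euclidean norm, such that $f(x)=\mathsf{sign}(\langle w(f),\phi(x)\rangle)$ for all $(x,f)\in\mathcal{X}\times\mathcal{F}$ (the norm bounds can be rescaled freely and are irrelevant here). Here $\mathsf{sign}(z)=1$ for $z>0$, $-1$ for $z<0$, and $\mathsf{sign}(0)=0$. *)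

theory Defs
  imports "HOL-Analysis.L2_Norm" "HOL-Library.FuncSet" "HOL-Library.Extended_Real"
begin

definition eluder_sequence ::
  "'a set \<Rightarrow> ('a \<Rightarrow> real) set \<Rightarrow> ('a \<Rightarrow> real) \<Rightarrow> nat \<Rightarrow> (nat \<Rightarrow> 'a) \<Rightarrow> (nat \<Rightarrow> 'a \<Rightarrow> real) \<Rightarrow> bool"
where
  "eluder_sequence X F fstar m x f \<longleftrightarrow>
     (\<forall>i\<in>{1..m}. x i \<in> X \<and> f i \<in> F \<and> f i (x i) \<noteq> fstar (x i) \<and>
        (\<forall>j\<in>{1..<i}. f i (x j) = fstar (x j)))"

text \<open>The supremum is taken in \<^typ>\<open>enat\<close>: the dimension is \<open>\<infinity>\<close> when the lengths are
  unbounded, and a finite value is attained as a maximum.\<close>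

definition Edim :: "'a set \<Rightarrow> ('a \<Rightarrow> real) set \<Rightarrow> ('a \<Rightarrow> real) \<Rightarrow> enat" where
  "Edim X F fstar = Sup {enat m | m. \<exists>x f. eluder_sequence X F fstar m x f}"

text \<open>Vectors of \<open>\<real>\<close>-dimension \<open>d\<close> are given by the components with index below \<open>d\<close> of a function
  on \<^typ>\<open>nat\<close>, since the dimension has to be quantified over. The library function \<^const>\<open>sgn\<close>
  satisfies \<open>sgn 0 = 0\<close>.\<close>

definition sign_representable :: "'a set \<Rightarrow> ('a \<Rightarrow> real) set \<Rightarrow> nat \<Rightarrow> bool" where
  "sign_representable X F d \<longleftrightarrow>
     (\<exists>(\<phi> :: 'a \<Rightarrow> nat \<Rightarrow> real) (w :: ('a \<Rightarrow> real) \<Rightarrow> nat \<Rightarrow> real).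
        (\<exists>B. \<forall>x\<in>X. L2_set (\<phi> x) {..<d} \<le> B) \<and>
        (\<exists>B. \<forall>f\<in>F. L2_set (w f) {..<d} \<le> B) \<and>
        (\<forall>x\<in>X. \<forall>f\<in>F. f x = sgn (\<Sum>k<d. w f k * \<phi> x k)))"

text \<open>The infimum is taken in \<^typ>\<open>enat\<close>: it is the least such \<open>d\<close>, or \<open>\<infinity>\<close> if there is none.\<close>

definition sign_rank :: "'a set \<Rightarrow> ('a \<Rightarrow> real) set \<Rightarrow> enat" where
  "sign_rank X F = Inf {enat d | d. sign_representable X F d}"

end

theory Submission
  imports Defs "HOL-Analysis.Function_Topology"
begin

text \<open>The proof is by counting. Take points \<open>(x, y)\<close> with \<open>x < k\<close>, \<open>y < 2k\<^sup>2\<close> and lines \<open>y = a x + b\<close> with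
  \<open>a < k\<close>, \<open>b < k\<^sup>2\<close>, where \<open>N\<close> is about \<open>2k\<^sup>3\<close>. For each of the \<open>2\<^bsup>k^4\<^esup>\<close> sets \<open>T\<close> of incidences,
  consider the functions that are \<open>+1\<close> exactly on the \<open>T\<close>-incident points of one line. Two distinct
  lines share at most one point, so each such class has eluder dimension at most 3, and a few
  additional functions make it exactly 4. If every class had sign-rank at most \<open>d\<close>, then all
  \<open>2\<^bsup>k^4\<^esup>\<close> patterns would be sign patterns of \<open>k\<^sup>4\<close> bilinear forms in \<open>3dk\<^sup>3\<close> variables.

  A family of \<open>M\<close> polynomials of degree \<open>D\<close> in \<open>n\<close> variables has at most \<open>(2DM + 1)\<^sup>n\<close> sign
  patterns. Let \<open>g\<close> be the product of the family and \<open>t\<close> large. In every sign cell,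
  \<open>t g\<^sup>2 - \<Sum>v\<^sub>i\<^bsup>2DM + 2\<^esup>\<close> has a critical point, and all these points satisfy equations
  \<open>v\<^sub>i\<^bsup>2DM + 1\<^esup> = P\<^sub>i(v)\<close> with \<open>deg P\<^sub>i \<le> 2DM\<close>. Such a system has at most \<open>(2DM + 1)\<^sup>n\<close> solutions.
  Hence \<open>2\<^bsup>k^4\<^esup> \<le> (4k\<^sup>4 + 1)\<^bsup>3dk^3\<^esup>\<close>, which gives even \<open>N\<^bsup>1/3\<^esup>/ln N\<close> as a lower bound up to a
  constant.\<close>

section \<open>Polynomial functions\<close>

text \<open>Polynomials are handled as plain functions, so evaluation, continuity and partial
  derivatives apply directly. \<open>n\<close> bounds the total degree; rule induction reduces
  linear statements to monomials.\<close>

inductive poly_fun :: "'i set \<Rightarrow> nat \<Rightarrow> (('i \<Rightarrow> real) \<Rightarrow> real) \<Rightarrow> bool" for I n where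
  monom: "(\<Sum>i\<in>I. a i) \<le> n \<Longrightarrow> poly_fun I n (\<lambda>v. \<Prod>i\<in>I. v i ^ a i)"
| add: "poly_fun I n p \<Longrightarrow> poly_fun I n q \<Longrightarrow> poly_fun I n (\<lambda>v. p v + q v)"
| scale: "poly_fun I n p \<Longrightarrow> poly_fun I n (\<lambda>v. c * p v)"

lemma poly_fun_mono: "poly_fun I m p \<Longrightarrow> m \<le> n \<Longrightarrow> poly_fun I n p"
  by (induction rule: poly_fun.induct) (auto intro: poly_fun.intros)

lemma poly_fun_const: "poly_fun I n (\<lambda>v. c)"
  using poly_fun.scale[OF poly_fun.monom[of "\<lambda>_. 0" I n], of c] by simp

lemma poly_fun_var:
  assumes "finite I" "i \<in> I" "n \<ge> 1"
  shows "poly_fun I n (\<lambda>v. v i)"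
proof -
  have "(\<Prod>j\<in>I. v j ^ (if j = i then 1 else 0)) = v i" for v :: "'a \<Rightarrow> real"
    using assms by (simp add: if_distrib[of "\<lambda>e. _ ^ e"] cong: if_cong)
  then show ?thesis
    using poly_fun.monom[of "\<lambda>j. if j = i then 1 else 0" I n] assms by simp
qed

lemma poly_fun_diff_const:
  assumes "poly_fun I n p"
  shows "poly_fun I n (\<lambda>v. p v - c)"
  using poly_fun.add[OF assms poly_fun_const[of I n "- c"]] by simp

lemma poly_fun_mult:
  assumes "poly_fun I m p" "poly_fun I n q"
  shows "poly_fun I (m + n) (\<lambda>v. p v * q v)"
  using assms(1)
proof (induction rule: poly_fun.induct)
  case (monom a)
  from assms(2) show ?case
  proof (induction rule: poly_fun.induct)
    case (monom b)
    show ?case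
      using poly_fun.monom[of "\<lambda>i. a i + b i" I "m + n"] monom \<open>sum a I \<le> m\<close>
      by (simp add: power_add prod.distrib sum.distrib)
  next
    case (add p q)
    then show ?case by (auto simp: distrib_left intro: poly_fun.add)
  next
    case (scale p c)
    then show ?case by (simp add: mult.left_commute poly_fun.scale)
  qed
next
  case (add p q)
  then show ?case by (auto simp: distrib_right intro: poly_fun.add)
next
  case (scale p c)
  then show ?case by (simp add: mult.assoc poly_fun.scale)
qed

lemma poly_fun_sum:
  assumes "\<And>j. j \<in> J \<Longrightarrow> poly_fun I n (f j)"
  shows "poly_fun I n (\<lambda>v. \<Sum>j\<in>J. f j v)"
  using assms
  by (induction J rule: infinite_finite_induct) (auto intro: poly_fun_const poly_fun.add)

lemma poly_fun_prod:
  assumes "finite J" "\<And>j. j \<in> J \<Longrightarrow> poly_fun I n (f j)"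
  shows "poly_fun I (n * card J) (\<lambda>v. \<Prod>j\<in>J. f j v)"
  using assms
  by (induction J rule: finite_induct) (auto intro: poly_fun_const poly_fun_mult)

lemma continuous_poly_fun:
  assumes "poly_fun I n p"
  shows "continuous_on UNIV p"
  using assms by induction (auto intro!: continuous_intros)

lemma poly_fun_cong:
  assumes "poly_fun I n p" "\<And>i. i \<in> I \<Longrightarrow> v i = u i"
  shows "p v = p u"
  using assms by induction (auto intro: prod.cong)

text \<open>The degree bound is not lowered to \<open>n - 1\<close>: for the critical point
  equations it suffices that differentiation does not raise the degree.\<close>

lemma poly_fun_deriv:
  assumes "poly_fun I n p" "finite I" "i \<in> I"
  shows "\<exists>q. poly_fun I n q \<and>
    (\<forall>v. ((\<lambda>t. p (v(i := t))) has_real_derivative q v) (at (v i)))"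
  using assms(1)
proof induction
  case (monom a)
  \<comment> \<open>If \<open>a i = 0\<close>, truncated subtraction leaves the exponent at 0, but
    then the factor \<open>real (a i)\<close> vanishes.\<close>
  let ?a = "a(i := a i - 1)"
  have split: "(\<Prod>j\<in>I. u j ^ b j) = u i ^ b i * (\<Prod>j\<in>I-{i}. u j ^ b j)"
    for u :: "'a \<Rightarrow> real" and b
    using assms by (simp add: prod.remove)
  have "((\<lambda>t. \<Prod>j\<in>I. (v(i := t)) j ^ a j) has_real_derivative
      real (a i) * (\<Prod>j\<in>I. v j ^ ?a j)) (at (v i))" for v
    by (auto simp: split intro!: derivative_eq_intros)
  moreover have "sum ?a I \<le> n"
    by (rule order_trans[OF sum_mono monom]) simp
  ultimately show ?case
    by (intro exI[of _ "\<lambda>v. real (a i) * (\<Prod>j\<in>I. v j ^ ?a j)"] conjI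
        poly_fun.scale poly_fun.monom) auto
next
  case (add p q)
  then obtain p' q' where pq: "poly_fun I n p'" "poly_fun I n q'"
    "\<And>v. ((\<lambda>t. p (v(i := t))) has_real_derivative p' v) (at (v i))"
    "\<And>v. ((\<lambda>t. q (v(i := t))) has_real_derivative q' v) (at (v i))"
    by blast
  show ?case
    by (rule exI[of _ "\<lambda>v. p' v + q' v"]) (intro conjI allI poly_fun.add DERIV_add pq)
next
  case (scale p c)
  then obtain p' where p: "poly_fun I n p'"
    "\<And>v. ((\<lambda>t. p (v(i := t))) has_real_derivative p' v) (at (v i))"
    by blast
  show ?case
    by (rule exI[of _ "\<lambda>v. c * p' v"]) (intro conjI allI poly_fun.scale DERIV_cmult p)
qed

text \<open>For \<open>R \<ge> 1\<close> monomials of lower degree are bounded by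
  \<open>R ^ n\<close> too. The purpose is that \<open>R ^ k\<close> with \<open>k > n\<close> wins
  for large \<open>R\<close>.\<close>

lemma poly_fun_growth:
  assumes "poly_fun I n p"
  shows "\<exists>C. \<forall>R\<ge>1. \<forall>v. (\<forall>i\<in>I. \<bar>v i\<bar> \<le> R) \<longrightarrow> \<bar>p v\<bar> \<le> C * R ^ n"
  using assms
proof induction
  case (monom a)
  have "\<bar>\<Prod>i\<in>I. v i ^ a i\<bar> \<le> 1 * R ^ n"
    if "R \<ge> 1" "\<forall>i\<in>I. \<bar>v i\<bar> \<le> R" for R and v :: "'a \<Rightarrow> real"
  proof -
    have "\<bar>\<Prod>i\<in>I. v i ^ a i\<bar> \<le> (\<Prod>i\<in>I. R ^ a i)"
      using that by (auto simp: abs_prod power_abs intro!: prod_mono power_mono)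
    also have "\<dots> = R ^ sum a I" by (rule power_sum[symmetric])
    also have "\<dots> \<le> R ^ n" using monom that by (intro power_increasing)
    finally show ?thesis by simp
  qed
  then show ?case by blast
next
  case (add p q)
  then obtain C D where
    C: "\<forall>R\<ge>1. \<forall>v. (\<forall>i\<in>I. \<bar>v i\<bar> \<le> R) \<longrightarrow> \<bar>p v\<bar> \<le> C * R ^ n" and
    D: "\<forall>R\<ge>1. \<forall>v. (\<forall>i\<in>I. \<bar>v i\<bar> \<le> R) \<longrightarrow> \<bar>q v\<bar> \<le> D * R ^ n"
    by blast
  have "\<bar>p v + q v\<bar> \<le> (C + D) * R ^ n" if "R \<ge> 1" "\<forall>i\<in>I. \<bar>v i\<bar> \<le> R" for R v
  proof -
    have "\<bar>p v + q v\<bar> \<le> \<bar>p v\<bar> + \<bar>q v\<bar>" by (rule abs_triangle_ineq)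
    also have "\<dots> \<le> C * R ^ n + D * R ^ n" using that C D by (intro add_mono) blast+
    finally show ?thesis by (simp add: distrib_right)
  qed
  then show ?case by blast
next
  case (scale p c)
  then obtain C where
    C: "\<forall>R\<ge>1. \<forall>v. (\<forall>i\<in>I. \<bar>v i\<bar> \<le> R) \<longrightarrow> \<bar>p v\<bar> \<le> C * R ^ n"
    by blast
  have "\<bar>c * p v\<bar> \<le> (\<bar>c\<bar> * C) * R ^ n" if "R \<ge> 1" "\<forall>i\<in>I. \<bar>v i\<bar> \<le> R" for R v
  proof -
    have "\<bar>p v\<bar> \<le> C * R ^ n" using that C by blast
    then show ?thesis by (simp add: abs_mult mult.assoc mult_left_mono)
  qed
  then show ?case by blast
qed

section \<open>Linear dependence and the number of solutions of a polynomial system\<close>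

text \<open>Gaussian elimination: a pivot \<open>M a b0\<close> removes the equation
  \<open>a\<close> and the unknown \<open>b0\<close> together, so the unknowns stay in the
  majority.\<close>

lemma underdetermined_homogeneous_system:
  fixes M :: "'a \<Rightarrow> 'b \<Rightarrow> real"
  assumes "finite A" "finite B" "card A < card B"
  shows "\<exists>c. (\<exists>b\<in>B. c b \<noteq> 0) \<and> (\<forall>a\<in>A. (\<Sum>b\<in>B. c b * M a b) = 0)"
  using assms
proof (induction A arbitrary: B M rule: finite_induct)
  case empty
  then obtain b where "b \<in> B" by fastforce
  then show ?case by (intro exI[of _ "\<lambda>_. 1"]) auto
next
  case (insert a A)
  show ?case
  proof (cases "\<forall>b\<in>B. M a b = 0")
    case True
    have "card A < card B" using insert by simp
    from insert.IH[OF insert.prems(1) this, of M] True show ?thesis by auto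
  next
    case False
    then obtain b0 where b0: "b0 \<in> B" "M a b0 \<noteq> 0" by blast
    let ?B = "B - {b0}"
    define M' where "M' e b = M e b - M a b / M a b0 * M e b0" for e b
    have "card A < card ?B" using insert b0 by simp
    from insert.IH[OF _ this, of M'] insert.prems obtain c where
      c: "\<exists>b\<in>?B. c b \<noteq> 0" "\<And>e. e \<in> A \<Longrightarrow> (\<Sum>b\<in>?B. c b * M' e b) = 0"
      by auto
    \<comment> \<open>The value at \<open>b0\<close> solves equation \<open>a\<close>; substituting
      it turns \<open>M\<close> into \<open>M'\<close> in the other equations.\<close>
    define c' where "c' = c(b0 := - (\<Sum>b\<in>?B. c b * M a b) / M a b0)"
    have sum: "(\<Sum>b\<in>B. c' b * M e b) = (\<Sum>b\<in>?B. c b * M' e b)" for e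
    proof -
      have "(\<Sum>b\<in>B. c' b * M e b) = c' b0 * M e b0 + (\<Sum>b\<in>?B. c' b * M e b)"
        using b0 insert.prems by (simp add: sum.remove)
      also have "(\<Sum>b\<in>?B. c' b * M e b) = (\<Sum>b\<in>?B. c b * M e b)"
        by (intro sum.cong) (auto simp: c'_def)
      also have "c' b0 * M e b0 = - (\<Sum>b\<in>?B. c b * (M a b / M a b0 * M e b0))"
        by (simp add: c'_def sum_distrib_right sum_divide_distrib mult.assoc)
      finally show ?thesis
        by (simp add: M'_def right_diff_distrib sum_subtractf)
    qed
    have "M' a b = 0" for b using b0 by (simp add: M'_def)
    then have "\<forall>e\<in>insert a A. (\<Sum>b\<in>B. c' b * M e b) = 0"
      using c by (simp add: sum)
    moreover have "\<exists>b\<in>B. c' b \<noteq> 0" using c by (auto simp: c'_def)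
    ultimately show ?thesis by blast
  qed
qed

text \<open>A weighted sum of point evaluations is linear in \<open>p\<close>, so monomials
  suffice.\<close>

lemma functional_eq_0_on_poly_fun:
  fixes c :: "('i \<Rightarrow> real) \<Rightarrow> real"
  assumes "poly_fun I n p"
    and "\<And>a. (\<Sum>i\<in>I. a i) \<le> n \<Longrightarrow> (\<Sum>z\<in>Z. c z * (\<Prod>i\<in>I. z i ^ a i)) = 0"
  shows "(\<Sum>z\<in>Z. c z * p z) = 0"
  using assms(1)
proof induction
  case (monom a)
  then show ?case by (rule assms(2))
next
  case (add p q)
  then show ?case by (simp add: distrib_left sum.distrib)
next
  case (scale p r)
  then show ?case by (simp add: mult.left_commute[of _ r] sum_distrib_left[symmetric])
qed

text \<open>If there were more solutions than monomials with all exponents below \<open>E\<close>, some nonzero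
  combination of point evaluations would vanish on those monomials. The equations rewrite
  \<open>v\<^sub>i\<^sup>E\<close> into lower degree, so it would vanish on all polynomials, including Lagrange's.\<close>

lemma card_solutions_triangular_system:
  assumes fin: "finite I" "finite Z"
    and sep: "\<And>z z'. z \<in> Z \<Longrightarrow> z' \<in> Z \<Longrightarrow> z \<noteq> z' \<Longrightarrow> \<exists>i\<in>I. z i \<noteq> z' i"
    and P: "\<And>i. i \<in> I \<Longrightarrow> poly_fun I m (P i)" "m < E"
    and eqs: "\<And>z i. z \<in> Z \<Longrightarrow> i \<in> I \<Longrightarrow> z i ^ E = P i z"
  shows "card Z \<le> E ^ card I"
proof (rule ccontr)
  assume "\<not> card Z \<le> E ^ card I"
  let ?A = "I \<rightarrow>\<^sub>E {..<E}"
  let ?M = "\<lambda>a z. \<Prod>i\<in>I. z i ^ a i"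
  have "finite ?A" using fin by (intro finite_PiE) auto
  moreover have "card ?A < card Z"
    using \<open>\<not> _\<close> fin by (simp add: card_PiE)
  ultimately obtain c z0 where z0: "z0 \<in> Z" "c z0 \<noteq> 0"
    and c: "\<And>a. a \<in> ?A \<Longrightarrow> (\<Sum>z\<in>Z. c z * ?M a z) = 0"
    using underdetermined_homogeneous_system[of ?A Z ?M] fin(2) by blast
  have monom: "(\<Sum>z\<in>Z. c z * ?M a z) = 0" for a
  proof (induction "\<Sum>i\<in>I. a i" arbitrary: a rule: less_induct)
    case less
    show ?case
    proof (cases "\<forall>i\<in>I. a i < E")
      case True
      then have "restrict a I \<in> ?A" by auto
      from c[OF this] show ?thesis by (simp cong: prod.cong)
    next
      case False
      then obtain i where i: "i \<in> I" "a i \<ge> E" by force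
      \<comment> \<open>Trading \<open>z i ^ E\<close> for \<open>P i z\<close> leaves total degree
        at most \<open>m + sum b I\<close>, which is below \<open>sum a I\<close> because
        \<open>m < E\<close>.\<close>
      define b where "b = a(i := a i - E)"
      have split: "(\<Prod>j\<in>I. u j ^ e j) = u i ^ e i * (\<Prod>j\<in>I-{i}. u j ^ e j)"
        for u :: "'a \<Rightarrow> real" and e
        using i fin by (simp add: prod.remove)
      have "?M a z = P i z * ?M b z" if "z \<in> Z" for z
      proof -
        have "z i ^ a i = z i ^ E * z i ^ b i"
          using i by (simp add: b_def power_add[symmetric])
        moreover have "(\<Prod>j\<in>I-{i}. z j ^ a j) = (\<Prod>j\<in>I-{i}. z j ^ b j)"
          by (intro prod.cong) (auto simp: b_def)
        ultimately show ?thesis using eqs[OF that i(1)] by (simp add: split)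
      qed
      then have "(\<Sum>z\<in>Z. c z * ?M a z) = (\<Sum>z\<in>Z. c z * (P i z * ?M b z))" by simp
      also have "\<dots> = 0"
      proof (rule functional_eq_0_on_poly_fun)
        show "poly_fun I (m + sum b I) (\<lambda>z. P i z * ?M b z)"
          using i by (intro poly_fun_mult P poly_fun.monom) auto
        have "sum a I = a i + sum a (I - {i})" "sum b I = b i + sum b (I - {i})"
          using i fin by (auto simp: sum.remove)
        moreover have "sum a (I - {i}) = sum b (I - {i})"
          by (intro sum.cong) (auto simp: b_def)
        moreover have "b i = a i - E" by (simp add: b_def)
        ultimately have "m + sum b I < sum a I" using i(2) P(2) by linarith
        then show "(\<Sum>z\<in>Z. c z * ?M e z) = 0" if "sum e I \<le> m + sum b I" for e
          using that by (intro less) auto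
      qed
      finally show ?thesis .
    qed
  qed
  \<comment> \<open>\<open>k z\<close> is a coordinate separating \<open>z\<close> from
    \<open>z0\<close>. The product \<open>L\<close> vanishes on \<open>Z\<close> except at
    \<open>z0\<close>, which forces \<open>c z0 = 0\<close>.\<close>
  obtain k where k: "\<And>z. z \<in> Z - {z0} \<Longrightarrow> k z \<in> I \<and> z0 (k z) \<noteq> z (k z)"
    using sep[OF z0(1)] by (metis DiffE insertI1)
  define L where "L = (\<lambda>v. \<Prod>z\<in>Z-{z0}. v (k z) - z (k z))"
  have "poly_fun I (1 * card (Z - {z0})) L"
    unfolding L_def using fin k
    by (intro poly_fun_prod poly_fun_diff_const poly_fun_var) auto
  then have "(\<Sum>z\<in>Z. c z * L z) = 0"
    by (rule functional_eq_0_on_poly_fun) (rule monom)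
  moreover have "L z = 0" if "z \<in> Z - {z0}" for z
    using that fin unfolding L_def by (auto intro!: prod_zero)
  ultimately have "c z0 * L z0 = 0"
    using z0 fin by (simp add: sum.remove[of Z z0])
  then show False using z0 k fin unfolding L_def by auto
qed

section \<open>Sign patterns of polynomials\<close>

text \<open>The critical point is a maximum of \<open>G - \<Sum>v\<^sub>i\<^sup>k\<close> over the closed cell where all \<open>f\<^sub>j \<ge> 0\<close>: this
  function is positive at \<open>u\<close>, nonpositive on the boundary of the cell, and negative far away.\<close>

lemma cell_critical_point:
  assumes fin: "finite I" "finite J"
    and f: "\<And>j. j \<in> J \<Longrightarrow> poly_fun I D (f j)"
    and G: "poly_fun I n G" "n < k" "even k"
    and bdry: "\<And>v j. j \<in> J \<Longrightarrow> f j v = 0 \<Longrightarrow> G v \<le> 0"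
    and u: "\<And>j. j \<in> J \<Longrightarrow> f j u > 0" "(\<Sum>i\<in>I. u i ^ k) < G u"
    and q: "\<And>i v. i \<in> I \<Longrightarrow> ((\<lambda>t. G (v(i := t))) has_real_derivative q i v) (at (v i))"
  shows "\<exists>z. (\<forall>j\<in>J. f j z > 0) \<and> (\<forall>i\<in>I. real k * z i ^ (k - 1) = q i z)"
proof -
  define Q where "Q = (\<lambda>v :: 'a \<Rightarrow> real. \<Sum>i\<in>I. v i ^ k)"
  define \<Psi> where "\<Psi> = (\<lambda>v. G v - Q v)"
  have Q_nonneg: "Q v \<ge> 0" for v
    unfolding Q_def using G by (intro sum_nonneg zero_le_even_power)
  obtain C where C: "\<And>R v. R \<ge> 1 \<Longrightarrow> \<forall>i\<in>I. \<bar>v i\<bar> \<le> R \<Longrightarrow> \<bar>G v\<bar> \<le> C * R ^ n"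
    using poly_fun_growth[OF G(1)] by blast
  \<comment> \<open>\<open>R > C\<close> and \<open>R \<ge> 1\<close> give
    \<open>C * R ^ n \<le> R ^ k\<close>, which keeps the maximum off the faces of the box; the last
    summand puts \<open>u\<close> inside.\<close>
  define R where "R = 1 + \<bar>C\<bar> + (\<Sum>i\<in>I. \<bar>u i\<bar>)"
  have "(\<Sum>i\<in>I. \<bar>u i\<bar>) \<ge> 0" by (intro sum_nonneg) auto
  then have R: "R \<ge> 1" "R > C" unfolding R_def by linarith+
  \<comment> \<open>Zeroing the coordinates outside \<open>I\<close> changes no value of
    \<open>f j\<close> or \<open>G\<close> and moves \<open>u\<close> into a box that is compact in
    the space of all functions.\<close>
  define u' where "u' = (\<lambda>i. if i \<in> I then u i else 0)"
  have u': "f j u' = f j u" if "j \<in> J" for j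
    by (rule poly_fun_cong[OF f[OF that]]) (simp add: u'_def)
  have "G u' = G u"
    by (rule poly_fun_cong[OF G(1)]) (simp add: u'_def)
  moreover have "Q u' = (\<Sum>i\<in>I. u i ^ k)"
    unfolding Q_def by (intro sum.cong) (auto simp: u'_def)
  ultimately have \<Psi>_u': "\<Psi> u' > 0" using u(2) by (simp add: \<Psi>_def)

  define B where "B = (\<Pi>\<^sub>E i\<in>UNIV. if i \<in> I then {- R..R} else {0::real})"
  define cell where "cell = B \<inter> (\<Inter>j\<in>J. {v. 0 \<le> f j v})"
  have "compactin (product_topology (\<lambda>_. euclidean) UNIV) B"
    unfolding B_def by (subst compactin_PiE) auto
  then have "compact B" by (simp add: euclidean_product_topology)
  moreover have "closed (\<Inter>j\<in>J. {v. 0 \<le> f j v})"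
    by (intro closed_INT ballI closed_Collect_le continuous_on_const continuous_poly_fun[OF f])
  ultimately have "compact cell" unfolding cell_def by (rule compact_Int_closed)
  moreover have "u' \<in> cell"
  proof -
    have "\<bar>u i\<bar> \<le> R" if "i \<in> I" for i
    proof -
      have "\<bar>u i\<bar> \<le> (\<Sum>i\<in>I. \<bar>u i\<bar>)" using that fin by (intro member_le_sum) auto
      then show ?thesis unfolding R_def by linarith
    qed
    then have "u' \<in> B" by (auto simp: B_def u'_def abs_le_iff minus_le_iff)
    then show ?thesis using u(1) u' by (auto simp: cell_def less_imp_le)
  qed
  moreover have "continuous_on cell \<Psi>"
  proof -
    have "continuous_on UNIV \<Psi>"
      unfolding \<Psi>_def Q_def
      by (intro continuous_intros continuous_poly_fun[OF G(1)] continuous_on_product_coordinates)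
    then show ?thesis by (rule continuous_on_subset) simp
  qed
  ultimately obtain z where z: "z \<in> cell" "\<And>y. y \<in> cell \<Longrightarrow> \<Psi> y \<le> \<Psi> z"
    using continuous_attains_sup[of cell \<Psi>] by blast
  have "\<Psi> z > 0" using z(2)[OF \<open>u' \<in> cell\<close>] \<Psi>_u' by linarith
  then have "G z > Q z" by (simp add: \<Psi>_def)
  have pos: "f j z > 0" if "j \<in> J" for j
  proof -
    have "f j z \<noteq> 0" using bdry[OF that, of z] \<open>G z > Q z\<close> Q_nonneg[of z] by fastforce
    then show ?thesis using z(1) that by (fastforce simp: cell_def)
  qed
  have z_B: "z i \<in> (if i \<in> I then {- R..R} else {0})" for i
    using z(1) unfolding cell_def B_def by blast
  have z_box: "\<bar>z i\<bar> \<le> R" if "i \<in> I" for i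
    using z_B[of i] that by auto
  have z_interior: "\<bar>z i\<bar> < R" if "i \<in> I" for i
  proof (rule ccontr)
    assume "\<not> \<bar>z i\<bar> < R"
    then have "\<bar>z i\<bar> = R" using z_box[OF that] by linarith
    then have "z i ^ k = R ^ k" using G(3) by (metis power_even_abs)
    then have "R ^ k \<le> Q z"
      unfolding Q_def using fin that G(3) member_le_sum[of i I "\<lambda>i. z i ^ k"]
      by (simp add: zero_le_even_power)
    also have "\<dots> < G z" by fact
    also have "\<dots> \<le> C * R ^ n" using C[of R z] R z_box by fastforce
    also have "\<dots> \<le> R * R ^ n" using R by (intro mult_right_mono) auto
    also have "\<dots> = R ^ Suc n" by simp
    also have "\<dots> \<le> R ^ k" using R G(2) by (intro power_increasing) auto
    finally show False by simp
  qed
  have "real k * z i ^ (k - 1) = q i z" if i: "i \<in> I" for i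
  proof -
    \<comment> \<open>Small changes of coordinate \<open>i\<close> stay in the cell, since all
      \<open>f j z\<close> are positive and \<open>z i\<close> is inside the box; so the derivative
      in this direction vanishes.\<close>
    have "\<forall>\<^sub>F t in nhds (z i). f j (z(i := t)) > 0" if j: "j \<in> J" for j
    proof -
      obtain f' where "((\<lambda>t. f j (z(i := t))) has_real_derivative f' z) (at (z i))"
        using poly_fun_deriv[OF f[OF j] fin(1) i] by blast
      then have "isCont (\<lambda>t. f j (z(i := t))) (z i)" by (rule DERIV_isCont)
      then have "((\<lambda>t. f j (z(i := t))) \<longlongrightarrow> f j z) (nhds (z i))"
        using tendsto_at_iff_tendsto_nhds[of "\<lambda>t. f j (z(i := t))" "z i"]
        by (simp add: isCont_def)
      from order_tendstoD(1)[OF this pos[OF j]] show ?thesis .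
    qed
    then have "\<forall>\<^sub>F t in nhds (z i). \<forall>j\<in>J. f j (z(i := t)) > 0"
      using fin by (simp add: eventually_ball_finite_distrib)
    moreover have "\<forall>\<^sub>F t in nhds (z i). t \<in> {-R<..<R}"
      using z_interior[OF i] by (intro eventually_nhds_in_open) (auto simp: abs_less_iff)
    ultimately have "\<forall>\<^sub>F t in nhds (z i). \<Psi> (z(i := t)) \<le> \<Psi> z"
    proof eventually_elim
      case (elim t)
      have "(z(i := t)) i' \<in> (if i' \<in> I then {- R..R} else {0})" for i'
        using z_B[of i'] elim i by (cases "i' = i") auto
      then have "z(i := t) \<in> B" unfolding B_def by blast
      then show ?case using elim by (intro z(2)) (auto simp: cell_def less_imp_le)
    qed
    then obtain d where d: "d > 0" "\<And>t. dist t (z i) < d \<Longrightarrow> \<Psi> (z(i := t)) \<le> \<Psi> z"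
      by (auto simp: eventually_nhds_metric)
    have Q_upd: "Q (z(i := t)) = t ^ k + (\<Sum>j\<in>I-{i}. z j ^ k)" for t
      unfolding Q_def using fin i by (simp add: sum.remove)
    have "((\<lambda>t. \<Psi> (z(i := t))) has_real_derivative q i z - real k * z i ^ (k - 1)) (at (z i))"
      unfolding \<Psi>_def Q_upd using G(2)
      by (auto intro!: derivative_eq_intros q[OF i] simp del: fun_upd_apply)
    from DERIV_local_max[OF this d(1)] d(2) show ?thesis
      by (simp add: dist_real_def abs_minus_commute)
  qed
  with pos show ?thesis by blast
qed

text \<open>A weak form of Warren's theorem.\<close>

lemma card_sign_patterns_le:
  fixes f :: "'j \<Rightarrow> ('i \<Rightarrow> real) \<Rightarrow> real"
  assumes fin: "finite I" "finite J"
    and f: "\<And>j. j \<in> J \<Longrightarrow> poly_fun I D (f j)"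
    and S: "S \<subseteq> Pow J"
    and realized: "\<And>s. s \<in> S \<Longrightarrow> \<exists>v. \<forall>j\<in>J. if j \<in> s then f j v > 0 else f j v < 0"
  shows "card S \<le> (2 * D * card J + 1) ^ card I"
proof -
  \<comment> \<open>Multiplying by \<open>\<sigma> s\<close> turns the pattern \<open>s\<close> into
    a cell where all functions are positive.\<close>
  define \<sigma> where "\<sigma> = (\<lambda>s (j::'j). if j \<in> s then 1 else - 1 :: real)"
  \<comment> \<open>Even, and \<open>k - 1\<close> still exceeds the degree bound of
    \<open>G\<close> and its derivatives.\<close>
  define k where "k = 2 * D * card J + 2"
  define g where "g = (\<lambda>v. \<Prod>j\<in>J. f j v)"
  have finS: "finite S" using S fin by (meson finite_Pow_iff finite_subset)
  have g: "poly_fun I (D * card J) g"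
    unfolding g_def by (intro poly_fun_prod fin f)
  have g2: "poly_fun I (D * card J + D * card J) (\<lambda>v. g v * g v)"
    by (intro poly_fun_mult g)
  have "\<exists>v. \<forall>j\<in>J. \<sigma> s j * f j v > 0" if "s \<in> S" for s
    using realized[OF that] by (metis (no_types, lifting) \<sigma>_def mult_1 mult_minus1 neg_0_less_iff_less)
  then obtain u where u: "\<And>s j. s \<in> S \<Longrightarrow> j \<in> J \<Longrightarrow> \<sigma> s j * f j (u s) > 0"
    by metis
  define Q where "Q = (\<lambda>v :: 'i \<Rightarrow> real. \<Sum>i\<in>I. v i ^ k)"
  \<comment> \<open>One \<open>t\<close> exceeds the quotients for all patterns, so \<open>G\<close>
    is the same in every cell and all critical points solve one common system.\<close>
  define t where "t = 1 + (\<Sum>s\<in>S. Q (u s) / (g (u s) * g (u s)))"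
  define G where "G = (\<lambda>v. t * (g v * g v))"
  have Q_nonneg: "Q v \<ge> 0" for v
    unfolding Q_def k_def by (intro sum_nonneg zero_le_even_power) auto
  have G: "poly_fun I (D * card J + D * card J) G"
    unfolding G_def by (intro poly_fun.scale g2)
  then obtain q where q: "\<And>i. i \<in> I \<Longrightarrow> poly_fun I (D * card J + D * card J) (q i)"
    "\<And>i v. i \<in> I \<Longrightarrow> ((\<lambda>t. G (v(i := t))) has_real_derivative q i v) (at (v i))"
    using poly_fun_deriv[OF G fin(1)] by metis
  have "\<exists>z. (\<forall>j\<in>J. \<sigma> s j * f j z > 0) \<and> (\<forall>i\<in>I. real k * z i ^ (k - 1) = q i z)" if s: "s \<in> S" for s
  proof (rule cell_critical_point[where f = "\<lambda>j v. \<sigma> s j * f j v" and u = "u s",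
        OF fin _ G _ _ _ u[OF s] _ q(2)])
    show "poly_fun I D (\<lambda>v. \<sigma> s j * f j v)" if "j \<in> J" for j
      by (intro poly_fun.scale f that)
    show "D * card J + D * card J < k" "even k" by (auto simp: k_def)
    show "G v \<le> 0" if "j \<in> J" "\<sigma> s j * f j v = 0" for v j
    proof -
      have "g v = 0" using that fin unfolding g_def \<sigma>_def by (auto split: if_splits)
      then show ?thesis by (simp add: G_def)
    qed
    have "g (u s) \<noteq> 0" using u[OF s] fin unfolding g_def by force
    then have pos: "g (u s) * g (u s) > 0" by (metis not_real_square_gt_zero)
    have "Q (u s) / (g (u s) * g (u s)) \<le> (\<Sum>s\<in>S. Q (u s) / (g (u s) * g (u s)))"
      using finS s Q_nonneg by (intro member_le_sum) auto
    then have "Q (u s) / (g (u s) * g (u s)) < t" by (simp add: t_def)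
    then show "(\<Sum>i\<in>I. u s i ^ k) < G (u s)"
      using pos by (simp add: G_def Q_def pos_divide_less_eq)
  qed
  then obtain z where z: "\<And>s j. s \<in> S \<Longrightarrow> j \<in> J \<Longrightarrow> \<sigma> s j * f j (z s) > 0"
    "\<And>s i. s \<in> S \<Longrightarrow> i \<in> I \<Longrightarrow> real k * z s i ^ (k - 1) = q i (z s)"
    by metis
  \<comment> \<open>\<open>z s\<close> realizes \<open>s\<close>, so different patterns have
    different critical points, already on \<open>I\<close>.\<close>
  have sep: "\<exists>i\<in>I. z s i \<noteq> z s' i" if "s \<in> S" "s' \<in> S" "s \<noteq> s'" for s s'
  proof (rule ccontr)
    assume "\<not> ?thesis"
    then have eq: "f j (z s) = f j (z s')" if "j \<in> J" for j
      using poly_fun_cong[OF f[OF that]] by blast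
    have "j \<in> s \<longleftrightarrow> j \<in> s'" if "j \<in> J" for j
      using z(1)[OF \<open>s \<in> S\<close> that] z(1)[OF \<open>s' \<in> S\<close> that] eq[OF that]
      by (auto simp: \<sigma>_def split: if_splits)
    then show False using that S by blast
  qed
  have "inj_on z S" by (rule inj_onI) (metis sep)
  then have "card S = card (z ` S)" by (rule card_image[symmetric])
  also have "\<dots> \<le> (k - 1) ^ card I"
  proof (rule card_solutions_triangular_system)
    show "poly_fun I (D * card J + D * card J) (\<lambda>v. 1 / real k * q i v)" if "i \<in> I" for i
      by (intro poly_fun.scale q that)
    show "D * card J + D * card J < k - 1" by (simp add: k_def)
    show "y i ^ (k - 1) = 1 / real k * q i y" if "y \<in> z ` S" "i \<in> I" for y i
    proof -
      have "real k * y i ^ (k - 1) = q i y" using that z(2) by auto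
      moreover have "real k \<noteq> 0" unfolding of_nat_eq_0_iff by (simp add: k_def)
      ultimately show ?thesis by (simp add: nonzero_eq_divide_eq mult.commute)
    qed
    show "\<exists>i\<in>I. y i \<noteq> y' i" if "y \<in> z ` S" "y' \<in> z ` S" "y \<noteq> y'" for y y'
      using that sep by blast
  qed (use fin finS in auto)
  finally show ?thesis by (simp add: k_def)
qed

section \<open>Partial lines and the eluder dimension\<close>

text \<open>The entries of all vectors become \<open>d * (card L + card P)\<close> variables. Each
  inner product has degree 2 in them, so the bound on sign patterns applies with
  \<open>D = 2\<close>.\<close>

lemma incidence_counting:
  fixes J :: "('l \<times> 'p) set"
  assumes fin: "finite L" "finite P" and J: "J \<subseteq> L \<times> P"
    and rep: "\<And>T. T \<subseteq> J \<Longrightarrow> \<exists>(w :: 'l \<Rightarrow> nat \<Rightarrow> real) \<phi>. \<forall>(l, p)\<in>J.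
      if (l, p) \<in> T then (\<Sum>i<d. w l i * \<phi> p i) > 0 else (\<Sum>i<d. w l i * \<phi> p i) < 0"
  shows "2 ^ card J \<le> (4 * card J + 1) ^ (d * (card L + card P))"
proof -
  define I :: "(('l \<times> nat) + ('p \<times> nat)) set" where "I = (L \<times> {..<d}) <+> (P \<times> {..<d})"
  define f :: "'l \<times> 'p \<Rightarrow> (('l \<times> nat) + ('p \<times> nat) \<Rightarrow> real) \<Rightarrow> real"
    where "f = (\<lambda>(l, p) v. \<Sum>i<d. v (Inl (l, i)) * v (Inr (p, i)))"
  have finI: "finite I" using fin by (simp add: I_def)
  have finJ: "finite J" using J fin by (meson finite_SigmaI finite_subset)
  have "card (Pow J) \<le> (2 * 2 * card J + 1) ^ card I"
  proof (rule card_sign_patterns_le[OF finI finJ])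
    show "poly_fun I 2 (f j)" if j_in: "j \<in> J" for j
    proof -
      obtain l p where j: "j = (l, p)" "l \<in> L" "p \<in> P" using j_in J by auto
      have "poly_fun I (1 + 1) (\<lambda>v. \<Sum>i<d. v (Inl (l, i)) * v (Inr (p, i)))"
        using j finI
        by (intro poly_fun_sum poly_fun_mult poly_fun_var) (auto simp: I_def)
      then show ?thesis by (simp add: f_def j numeral_2_eq_2)
    qed
  next
    fix T assume "T \<in> Pow J"
    then obtain w :: "'l \<Rightarrow> nat \<Rightarrow> real" and \<phi> where *: "\<forall>(l, p)\<in>J.
      if (l, p) \<in> T then (\<Sum>i<d. w l i * \<phi> p i) > 0 else (\<Sum>i<d. w l i * \<phi> p i) < 0"
      using rep by blast
    define v where "v = case_sum (\<lambda>(l, i). w l i) (\<lambda>(p, i). \<phi> p i)"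
    have "f (l, p) v = (\<Sum>i<d. w l i * \<phi> p i)" for l p
      by (simp add: f_def v_def)
    then have "\<forall>j\<in>J. if j \<in> T then 0 < f j v else f j v < 0"
      using * by auto
    then show "\<exists>v. \<forall>j\<in>J. if j \<in> T then 0 < f j v else f j v < 0"
      by (intro exI[of _ v])
  qed simp
  moreover have "card I = d * (card L + card P)"
    using fin by (simp add: I_def card_Plus card_cartesian_product algebra_simps)
  ultimately show ?thesis using finJ by (simp add: card_Pow)
qed

section \<open>Sign functions of sets and their eluder dimension\<close>

definition sign_fun :: "nat \<Rightarrow> nat set \<Rightarrow> nat \<Rightarrow> real" where
  "sign_fun N B = (\<lambda>x\<in>{1..N}. if x \<in> B then 1 else - 1)"

lemma sign_fun_eq_1_iff: "x \<in> {1..N} \<Longrightarrow> sign_fun N B x = 1 \<longleftrightarrow> x \<in> B"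
  by (simp add: sign_fun_def)

lemma sign_fun_UNIV: "sign_fun N UNIV = (\<lambda>x\<in>{1..N}. 1)"
  by (simp add: sign_fun_def)

text \<open>In an eluder sequence for sets meeting pairwise in at most one point, the third and the fourth
  set are distinct and share the first two points; so its length is at most 3, and
  the additional set \<open>{1, 2, 3}\<close> occurs at most once.\<close>

lemma Edim_linear_space:
  assumes "N \<ge> 4" and basic: "{} \<in> \<B>" "{1} \<in> \<B>" "{1, 2} \<in> \<B>"
    and linear: "\<And>B B' p p'. B \<in> \<B> \<Longrightarrow> B' \<in> \<B> \<Longrightarrow> B \<noteq> B' \<Longrightarrow>
      {p, p'} \<subseteq> B \<inter> B' \<Longrightarrow> p = p'"
  shows "Edim {1..N} (sign_fun N ` ({UNIV, {1, 2, 3}} \<union> \<B>)) (\<lambda>x\<in>{1..N}. 1) = 4"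
    (is "Edim ?X ?F ?one = 4")
proof -
  have "m \<le> 4" if seq: "eluder_sequence ?X ?F ?one m x f" for m x f
  proof (rule ccontr)
    assume m: "\<not> m \<le> 4"
    have F: "f i \<in> ?F" and X: "x i \<in> ?X" and neq: "f i (x i) \<noteq> ?one (x i)"
      and eq: "\<forall>j\<in>{1..<i}. f i (x j) = ?one (x j)" if i: "i \<in> {1..5}" for i
    proof -
      have "i \<in> {1..m}" using i m by simp
      then show "f i \<in> ?F" "x i \<in> ?X" "f i (x i) \<noteq> ?one (x i)"
          "\<forall>j\<in>{1..<i}. f i (x j) = ?one (x j)"
        using seq unfolding eluder_sequence_def by blast+
    qed
    have "\<exists>B. B \<in> {UNIV, {1, 2, 3}} \<union> \<B> \<and> x i \<notin> B \<and> (\<forall>j\<in>{1..<i}. x j \<in> B)"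
      if i: "i \<in> {1..5}" for i
    proof -
      obtain B where B: "B \<in> {UNIV, {1, 2, 3}} \<union> \<B>" "f i = sign_fun N B"
        using F[OF i] by blast
      have "x i \<notin> B"
        using neq[OF i] X[OF i] by (auto simp: B sign_fun_def)
      moreover have "x j \<in> B" if j: "j \<in> {1..<i}" for j
      proof -
        have "x j \<in> ?X" using X i j by auto
        moreover have "sign_fun N B (x j) = ?one (x j)" using eq[OF i] j B by metis
        ultimately show ?thesis using sign_fun_eq_1_iff by fastforce
      qed
      ultimately show ?thesis using B(1) by blast
    qed
    then obtain B where B: "\<And>i. i \<in> {1..5} \<Longrightarrow> B i \<in> {UNIV, {1, 2, 3}} \<union> \<B>"
      "\<And>i. i \<in> {1..5} \<Longrightarrow> x i \<notin> B i"
      "\<And>i j. i \<in> {1..5} \<Longrightarrow> j \<in> {1..<i} \<Longrightarrow> x j \<in> B i"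
      by metis
    have ne: "B i \<noteq> B j" if "i \<in> {1..5}" "j \<in> {1..<i}" for i j
      using B(3)[OF that] B(2)[of j] that by auto
    have "x 1 \<noteq> x 2" using B(2)[of 2] B(3)[of 2 1] by auto
    then have no_pair: False if "i \<in> {1..5}" "j \<in> {3..<i}" "B i \<in> \<B>" "B j \<in> \<B>" for i j
      using linear[of "B i" "B j" "x 1" "x 2"] that ne[of i j] B(3)[of i 1] B(3)[of i 2]
        B(3)[of j 1] B(3)[of j 2] by auto
    have cases: "B i = {1, 2, 3} \<or> B i \<in> \<B>" if "i \<in> {1..5}" for i
      using B(1,2)[OF that] by auto
    \<comment> \<open>\<open>B 3\<close>, \<open>B 4\<close>, \<open>B 5\<close> are distinct and at
      most one is \<open>{1, 2, 3}\<close>, so two of them lie in \<open>\<B>\<close> and share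
      \<open>x 1\<close> and \<open>x 2\<close>.\<close>
    show False
      using cases[of 3] cases[of 4] cases[of 5] no_pair[of 4 3] no_pair[of 5 3] no_pair[of 5 4]
        ne[of 4 3] ne[of 5 3] ne[of 5 4] by auto
  qed
  then have "Edim ?X ?F ?one \<le> 4"
    unfolding Edim_def by (intro Sup_least) (auto simp: numeral_eq_enat)
  \<comment> \<open>The points 1, 2, 3, 4 go with the sets \<open>{}\<close>, \<open>{1}\<close>,
    \<open>{1, 2}\<close>, \<open>{1, 2, 3}\<close>.\<close>
  moreover have "eluder_sequence ?X ?F ?one 4 (\<lambda>i. i) (\<lambda>i. sign_fun N {1..<i})"
    unfolding eluder_sequence_def
  proof
    fix i :: nat assume i: "i \<in> {1..4}"
    then consider "i = 1" | "i = 2" | "i = 3" | "i = 4" by force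
    then have "{1..<i} \<in> {UNIV, {1, 2, 3}} \<union> \<B>"
    proof cases
      case 1
      then have "{1..<i} = {}" by auto
      then show ?thesis by (metis UnI2 basic(1))
    next
      case 2
      then have "{1..<i} = {1}" by auto
      then show ?thesis by (metis UnI2 basic(2))
    next
      case 3
      then have "{1..<i} = {1, 2}" by auto
      then show ?thesis by (metis UnI2 basic(3))
    next
      case 4
      then have "{1..<i} = {1, 2, 3}" by auto
      then show ?thesis by (metis UnI1 insertI1 insertI2)
    qed
    then have "sign_fun N {1..<i} \<in> ?F" by (rule imageI)
    moreover have "i \<in> ?X" "sign_fun N {1..<i} i \<noteq> ?one i"
      "\<forall>j\<in>{1..<i}. sign_fun N {1..<i} j = ?one j"
      using i \<open>N \<ge> 4\<close> by (auto simp: sign_fun_def)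
    ultimately show "i \<in> ?X \<and> sign_fun N {1..<i} \<in> ?F \<and> sign_fun N {1..<i} i \<noteq> ?one i \<and>
        (\<forall>j\<in>{1..<i}. sign_fun N {1..<i} j = ?one j)"
      by blast
  qed
  then have "4 \<le> Edim ?X ?F ?one"
    unfolding Edim_def by (intro Sup_upper) (auto simp: numeral_eq_enat)
  ultimately show ?thesis by (rule antisym)
qed

text \<open>Either no dimension works and the rank is infinite, or the infimum is attained because
  \<open>enat\<close> is well-ordered.\<close>

lemma sign_rank_geI:
  assumes "\<And>d. sign_representable X F d \<Longrightarrow> r \<le> real d"
  shows "ereal r \<le> ereal_of_enat (sign_rank X F)"
proof (cases "{enat d | d. sign_representable X F d} = {}")
  case True
  then have "sign_rank X F = \<infinity>"
    unfolding sign_rank_def by (simp only: Inf_empty top_enat_def)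
  then show ?thesis by simp
next
  case False
  then obtain e where "e \<in> {enat d | d. sign_representable X F d}" by blast
  then have "sign_rank X F \<in> {enat d | d. sign_representable X F d}"
    unfolding sign_rank_def by (rule wellorder_InfI)
  then obtain d where "sign_rank X F = enat d" "sign_representable X F d" by blast
  then show ?thesis using assms by simp
qed

section \<open>Lines and points of a grid\<close>

text \<open>Encodes the point \<open>(x, a x + b)\<close> of the line \<open>y = a x + b\<close>; the numbers \<open>1, \<dots>, 4\<close> stay free.\<close>

definition line_point :: "nat \<Rightarrow> nat \<times> nat \<Rightarrow> nat \<Rightarrow> nat" where
  "line_point k l x = 5 + (fst l * x + snd l) * k + x"

definition lines :: "nat \<Rightarrow> (nat \<times> nat) set" where
  "lines k = {..<k} \<times> {..<k ^ 2}"

definition incidences :: "nat \<Rightarrow> ((nat \<times> nat) \<times> nat) set" where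
  "incidences k = (\<lambda>(l, x). (l, line_point k l x)) ` (lines k \<times> {..<k})"

text \<open>After removing the offset 5, \<open>x\<close> is the last digit in base
  \<open>k\<close>, so \<open>mod k\<close> and \<open>div k\<close> recover both
  coordinates.\<close>

lemma line_point_eq_iff:
  assumes "x < k" "x' < k"
  shows "line_point k l x = line_point k l' x' \<longleftrightarrow>
    x = x' \<and> fst l * x + snd l = fst l' * x' + snd l'"
proof
  assume "line_point k l x = line_point k l' x'"
  then have eq: "(fst l * x + snd l) * k + x = (fst l' * x' + snd l') * k + x'"
    by (simp add: line_point_def)
  show "x = x' \<and> fst l * x + snd l = fst l' * x' + snd l'"
    using arg_cong[OF eq, of "\<lambda>n. n mod k"] arg_cong[OF eq, of "\<lambda>n. n div k"] assms
    by simp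
qed (auto simp: line_point_def)

lemma card_incidences: "card (incidences k) = k ^ 4"
proof -
  have "inj_on (\<lambda>(l, x). (l, line_point k l x)) (lines k \<times> {..<k})"
    by (auto simp: inj_on_def line_point_eq_iff)
  then show ?thesis
    by (simp add: incidences_def card_image lines_def card_cartesian_product
        power2_eq_square power4_eq_xxxx)
qed

lemma incidences_subset: "incidences k \<subseteq> lines k \<times> {5..<5 + 2 * k ^ 3}"
proof -
  have "line_point k l x < 5 + 2 * k ^ 3" if "l \<in> lines k" "x < k" for l x
  proof -
    have "fst l * x \<le> (k - 1) * (k - 1)" "snd l \<le> k ^ 2 - 1"
      using that by (auto simp: lines_def intro!: mult_mono)
    \<comment> \<open>The added 1 makes room for \<open>x < k\<close> in the encoding
      \<open>y * k + x\<close>.\<close>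
    moreover have "(k - 1) * (k - 1) + (k ^ 2 - 1) + 1 \<le> 2 * k ^ 2"
      using that by (cases k) (auto simp: power2_eq_square)
    ultimately have "fst l * x + snd l + 1 \<le> 2 * k ^ 2" by linarith
    then have "(fst l * x + snd l + 1) * k \<le> 2 * k ^ 2 * k" by (rule mult_right_mono) simp
    also have "\<dots> = 2 * k ^ 3" by (simp add: power2_eq_square power3_eq_cube)
    finally show ?thesis using that by (simp add: line_point_def algebra_simps)
  qed
  then show ?thesis by (auto simp: incidences_def line_point_def)
qed

lemma incidences_linear:
  assumes "(l, p) \<in> incidences k" "(l, p') \<in> incidences k"
    and "(l', p) \<in> incidences k" "(l', p') \<in> incidences k" and "l \<noteq> l'"
  shows "p = p'"
proof (rule ccontr)
  assume "p \<noteq> p'"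
  obtain x x' where x: "x < k" "x' < k" "p = line_point k l x" "p' = line_point k l x'"
    using assms(1,2) by (auto simp: incidences_def)
  obtain y y' where y: "y < k" "y' < k" "p = line_point k l' y" "p' = line_point k l' y'"
    using assms(3,4) by (auto simp: incidences_def)
  have "x = y" "x' = y'" and
    nat_eqs: "fst l * x + snd l = fst l' * x + snd l'" "fst l * x' + snd l = fst l' * x' + snd l'"
    using x y by (auto simp: line_point_eq_iff)
  have "x \<noteq> x'" using x \<open>p \<noteq> p'\<close> by auto
  \<comment> \<open>Subtracting the two equations gives a product of differences equal to 0;
    integers avoid truncated subtraction.\<close>
  have "int (fst l) * int x + int (snd l) = int (fst l') * int x + int (snd l')"
    "int (fst l) * int x' + int (snd l) = int (fst l') * int x' + int (snd l')"
    using nat_eqs by (metis of_nat_add of_nat_mult)+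
  then have "(int (fst l) - int (fst l')) * (int x - int x') = 0"
    by (simp add: algebra_simps)
  then have "fst l = fst l'" using \<open>x \<noteq> x'\<close> by simp
  moreover from this have "snd l = snd l'" using nat_eqs by simp
  ultimately show False using \<open>l \<noteq> l'\<close> by (simp add: prod_eq_iff)
qed

text \<open>\<open>UNIV\<close> supplies the constant 1. The small sets live on the free points and
  force dimension 4 without meeting any line.\<close>

definition partial_line_class :: "nat \<Rightarrow> nat \<Rightarrow> ((nat \<times> nat) \<times> nat) set \<Rightarrow> (nat \<Rightarrow> real) set" where
  "partial_line_class N k T = sign_fun N `
     ({UNIV, {1, 2, 3}} \<union> ({{}, {1}, {1, 2}} \<union> (\<lambda>l. T `` {l}) ` lines k))"

lemma Edim_partial_line_class:
  assumes "N \<ge> 4" "T \<subseteq> incidences k"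
  shows "Edim {1..N} (partial_line_class N k T) (\<lambda>x\<in>{1..N}. 1) = 4"
  unfolding partial_line_class_def
proof (rule Edim_linear_space)
  fix B B' p p'
  assume B: "B \<in> {{}, {1}, {1, 2}} \<union> (\<lambda>l. T `` {l}) ` lines k"
    "B' \<in> {{}, {1}, {1, 2}} \<union> (\<lambda>l. T `` {l}) ` lines k"
    "B \<noteq> B'" "{p, p'} \<subseteq> B \<inter> B'"
  \<comment> \<open>Small sets and line sets are disjoint, so a shared point forces both sets to be
    of the same kind.\<close>
  have ge5: "q \<ge> 5" if "q \<in> T `` {l}" for q l
    using that assms(2) incidences_subset by fastforce
  have le2: "q \<le> 2" if "q \<in> A" "A \<in> {{}, {1}, {1, 2}}" for q :: nat and A
    using that by auto
  show "p = p'"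
  proof (cases "B \<in> {{}, {1}, {1, 2}}")
    case True
    then have "p \<le> 2" using B(4) le2 by blast
    have "B' \<in> {{}, {1}, {1, 2}}"
    proof (rule ccontr)
      assume "B' \<notin> {{}, {1}, {1, 2}}"
      then obtain l where "B' = T `` {l}" using B(2) by blast
      then have "p \<ge> 5" using B(4) by (intro ge5[of p l]) blast
      with \<open>p \<le> 2\<close> show False by simp
    qed
    with True show ?thesis using B(3,4) by auto
  next
    case False
    then obtain l where l: "B = T `` {l}" using B(1) by blast
    then have "p \<ge> 5" using B(4) by (intro ge5[of p l]) blast
    then have "B' \<notin> {{}, {1}, {1, 2}}" using B(4) le2[of p B'] by auto
    then obtain l' where l': "B' = T `` {l'}" using B(2) by blast
    have "l \<noteq> l'" using B(3) l l' by blast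
    then show ?thesis
      using l l' B(4) assms(2) by (intro incidences_linear[of l p k p' l']) blast+
  qed
qed (use assms in auto)

section \<open>Choice of the set of incidences\<close>

lemma ln_2_ge_half: "1 / 2 \<le> ln (2::real)"
  using ln_le_minus_one[of "1/2 :: real"] by (simp add: ln_div)

text \<open>If every \<open>T\<close> failed, each in a dimension \<open>\<delta> T\<close>, the
  largest of these would serve all \<open>2 ^ (k ^ 4)\<close> subsets at once, too many for
  \<open>incidence_counting\<close>.\<close>

lemma exists_partial_line_class:
  assumes N: "4 + 2 * k ^ 3 \<le> N"
  shows "\<exists>T\<subseteq>incidences k. \<forall>d. sign_representable {1..N} (partial_line_class N k T) d \<longrightarrow>
    real k \<le> 12 * real d * ln (real N)"
proof (rule ccontr)
  let ?J = "incidences k"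
  assume "\<not> ?thesis"
  then obtain \<delta> where \<delta>: "\<And>T. T \<subseteq> ?J \<Longrightarrow>
      sign_representable {1..N} (partial_line_class N k T) (\<delta> T) \<and>
      12 * real (\<delta> T) * ln (real N) < real k"
    unfolding not_le[symmetric] by metis
  define d where "d = Max (\<delta> ` Pow ?J)"
  have finJ: "finite ?J" by (simp add: incidences_def lines_def)
  have \<delta>_le: "\<delta> T \<le> d" if "T \<subseteq> ?J" for T
    unfolding d_def using that finJ by (intro Max_ge) auto
  have "d \<in> \<delta> ` Pow ?J" unfolding d_def using finJ by (intro Max_in) auto
  then have d: "12 * real d * ln (real N) < real k" using \<delta> by auto
  have "2 ^ card ?J \<le> (4 * card ?J + 1) ^ (d * (card (lines k) + card {5..<5 + 2 * k ^ 3}))"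
  proof (rule incidence_counting[OF _ _ incidences_subset])
    fix T assume T: "T \<subseteq> ?J"
    from \<delta>[OF T] obtain \<phi> w where rep: "\<And>x f. x \<in> {1..N} \<Longrightarrow> f \<in> partial_line_class N k T \<Longrightarrow>
        f x = sgn (\<Sum>i<\<delta> T. w f i * \<phi> x i)"
      unfolding sign_representable_def by blast
    \<comment> \<open>Padding with zeros brings every representation to the common dimension
      \<open>d\<close>.\<close>
    define w' where "w' = (\<lambda>l i. if i < \<delta> T then w (sign_fun N (T `` {l})) i else 0)"
    have "if (l, p) \<in> T then (\<Sum>i<d. w' l i * \<phi> p i) > 0 else (\<Sum>i<d. w' l i * \<phi> p i) < 0"
      if "(l, p) \<in> ?J" for l p
    proof -
      have lp: "l \<in> lines k" "p \<in> {1..N}" using that incidences_subset[of k] N by auto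
      have "(\<Sum>i<d. w' l i * \<phi> p i) = (\<Sum>i<\<delta> T. w (sign_fun N (T `` {l})) i * \<phi> p i)"
        using \<delta>_le[OF T] by (intro sum.mono_neutral_cong_right) (auto simp: w'_def)
      also have "sgn \<dots> = sign_fun N (T `` {l}) p"
        using lp by (intro rep[symmetric]) (auto simp: partial_line_class_def)
      also have "\<dots> = (if (l, p) \<in> T then 1 else - 1)"
        using lp by (simp add: sign_fun_def)
      finally show ?thesis by (auto simp: sgn_if split: if_splits)
    qed
    then show "\<exists>w \<phi>. \<forall>(l, p)\<in>?J. if (l, p) \<in> T then (\<Sum>i<d. w l i * \<phi> p i) > (0::real)
        else (\<Sum>i<d. w l i * \<phi> p i) < 0"
      by blast
  qed (auto simp: lines_def)
  also have "card (lines k) + card {5..<5 + 2 * k ^ 3} = 3 * k ^ 3"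
    by (simp add: lines_def card_cartesian_product power2_eq_square power3_eq_cube)
  also have "(4 * card ?J + 1) ^ (d * (3 * k ^ 3)) \<le> (N ^ 2) ^ (d * (3 * k ^ 3))"
  proof (rule power_mono)
    \<comment> \<open>Bounding the base by \<open>N ^ 2\<close> turns its logarithm into
      \<open>2 * ln N\<close>.\<close>
    have "k ^ 4 \<le> k ^ 6" by (cases "k = 0") (auto intro: power_increasing)
    then have "4 * k ^ 4 + 1 \<le> 4 * k ^ 6 + 16" by simp
    also have "\<dots> \<le> (4 + 2 * k ^ 3) ^ 2"
      by (simp add: power2_eq_square algebra_simps flip: power_add)
    also have "\<dots> \<le> N ^ 2" using N by (intro power_mono) auto
    finally show "4 * card ?J + 1 \<le> N ^ 2" by (simp add: card_incidences)
  qed simp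
  finally have "2 ^ (k ^ 4) \<le> N ^ (2 * (d * (3 * k ^ 3)))"
    by (simp only: card_incidences power_mult[symmetric])
  then have "(2::real) ^ (k ^ 4) \<le> real N ^ (2 * (d * (3 * k ^ 3)))"
    by (metis of_nat_le_iff of_nat_numeral of_nat_power)
  then have "ln ((2::real) ^ (k ^ 4)) \<le> ln (real N ^ (2 * (d * (3 * k ^ 3))))"
    using N by (intro ln_mono) auto
  then have le: "real k ^ 4 * ln 2 \<le> 6 * real d * real k ^ 3 * ln (real N)"
    using N by (simp add: ln_realpow mult_ac)
  have "k > 0" using d N by (cases k) (auto simp: mult_less_0_iff)
  then have "real k ^ 3 * (real k * ln 2) \<le> real k ^ 3 * (6 * real d * ln (real N))"
    using le by (simp add: eval_nat_numeral mult_ac)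
  then have "real k * ln 2 \<le> 6 * real d * ln (real N)"
    using \<open>k > 0\<close> by simp
  \<comment> \<open>The 12 arises as 2 from \<open>N ^ 2\<close>, 3 from \<open>3 * k ^ 3\<close>,
    and 2 from \<open>ln 2 \<ge> 1 / 2\<close>.\<close>
  moreover have "real k * (1 / 2) \<le> real k * ln 2"
    by (intro mult_left_mono ln_2_ge_half) auto
  ultimately show False using d by linarith
qed

section \<open>Choice of the grid size and comparison of constants\<close>

theorem theorem10:
  "\<exists>c::real. c > 0 \<and>
     (\<forall>N::nat. N \<ge> 4 \<longrightarrow>
        (\<exists>F :: (nat \<Rightarrow> real) set.
           F \<subseteq> ({1..N} \<rightarrow>\<^sub>E {1, -1}) \<and>
           (\<lambda>x\<in>{1..N}. 1) \<in> F \<and>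
           Edim {1..N} F (\<lambda>x\<in>{1..N}. 1) = 4 \<and>
           ereal_of_enat (sign_rank {1..N} F) \<ge> ereal (c * (real N powr (1/9) / ln (real N)))))"
proof (rule exI[of _ "1/36"], intro conjI allI impI)
  fix N :: nat assume N: "N \<ge> 4"
  \<comment> \<open>The largest \<open>k\<close> with \<open>4 + 2 * k ^ 3 \<le> N\<close>; it is 0
    for \<open>N < 6\<close>.\<close>
  define k where "k = (LEAST k. N < 4 + 2 * (k + 1) ^ 3)"
  have "N < 4 + 2 * (N + 1) ^ 3"
    using power_increasing[of 1 3 "N + 1"] by simp
  then have k_upper: "N < 4 + 2 * (k + 1) ^ 3" unfolding k_def by (rule LeastI)
  have k_lower: "4 + 2 * k ^ 3 \<le> N"
  proof (cases k)
    case (Suc k')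
    then show ?thesis using not_less_Least[of k' "\<lambda>k. N < 4 + 2 * (k + 1) ^ 3"]
      by (simp add: k_def)
  qed (use N in simp)
  then obtain T where T: "T \<subseteq> incidences k"
    "\<And>d. sign_representable {1..N} (partial_line_class N k T) d \<Longrightarrow>
      real k \<le> 12 * real d * ln (real N)"
    using exists_partial_line_class by blast
  let ?F = "partial_line_class N k T"
  have one: "(\<lambda>x\<in>{1..N}. 1) \<in> ?F"
    unfolding sign_fun_UNIV[symmetric] partial_line_class_def by blast
  have ln_N: "ln (real N) \<ge> 1"
  proof -
    have "ln (4::real) = 2 * ln 2"
      using ln_realpow[of "2::real" 2] by simp
    moreover have "ln 4 \<le> ln (real N)" using N by (intro ln_mono) auto
    ultimately show ?thesis using ln_2_ge_half by linarith
  qed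
  \<comment> \<open>The maximum with 1 covers the case \<open>k = 0\<close>.\<close>
  define M where "M = max 1 k"
  have N_le: "real N powr (1/9) \<le> 3 * real M"
  proof -
    have M3: "1 \<le> M ^ 3" by (intro one_le_power) (simp add: M_def)
    have "(k + 1) ^ 3 \<le> (2 * M) ^ 3" by (intro power_mono) (auto simp: M_def)
    then have "N \<le> 4 + 2 * (2 * M) ^ 3" using k_upper by linarith
    also have "\<dots> \<le> 27 * M ^ 3" using M3 by (simp add: power_mult_distrib)
    also have "\<dots> = (3 * M) ^ 3" by (simp add: power_mult_distrib)
    \<comment> \<open>The exponent 3 is weakened to 9 to match the claimed root.\<close>
    also have "\<dots> \<le> (3 * M) ^ 9" by (intro power_increasing) (auto simp: M_def)
    finally have "real N \<le> (3 * real M) ^ 9"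
      by (metis of_nat_le_iff of_nat_mult of_nat_numeral of_nat_power)
    then have "real N powr (1/9) \<le> ((3 * real M) ^ 9) powr (1/9)"
      by (intro powr_mono2) auto
    also have "(3 * real M) ^ 9 = (3 * real M) powr 9"
      by (simp add: M_def)
    also have "\<dots> powr (1/9) = 3 * real M"
      unfolding powr_powr by (simp add: M_def)
    finally show ?thesis .
  qed
  have M_le: "real M \<le> 12 * real d * ln (real N)" if rep: "sign_representable {1..N} ?F d" for d
  proof -
    \<comment> \<open>In dimension 0 every inner product is 0, and \<open>sgn 0 = 0\<close> differs
      from the value 1. Hence \<open>d * ln N \<ge> 1\<close>, which settles
      \<open>M = 1\<close>.\<close>
    have "d \<noteq> 0"
    proof
      assume "d = 0"
      from rep obtain \<phi> w where
        "\<forall>x\<in>{1..N}. \<forall>f\<in>?F. f x = sgn (\<Sum>k<d. w f k * \<phi> x k :: real)"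
        unfolding sign_representable_def by blast
      moreover have "1 \<in> {1..N}" using N by simp
      ultimately have "(\<lambda>x\<in>{1..N}. 1) (1::nat) =
          sgn (\<Sum>k<d. w (\<lambda>x\<in>{1..N}. 1) k * \<phi> 1 k)"
        using one by blast
      then show False using N \<open>d = 0\<close> by simp
    qed
    then have "1 * 1 \<le> real d * ln (real N)" using ln_N by (intro mult_mono) auto
    then show ?thesis using T(2)[OF rep] by (simp add: M_def max_def)
  qed
  have "1/36 * (real N powr (1/9) / ln (real N)) \<le> real d"
    if "sign_representable {1..N} ?F d" for d
  proof -
    \<comment> \<open>36 is 3 from \<open>N_le\<close> times 12 from \<open>M_le\<close>.\<close>
    have "real N powr (1/9) \<le> 36 * real d * ln (real N)"
      using N_le M_le[OF that] by linarith
    then show ?thesis using ln_N by (simp add: field_simps)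
  qed
  then have "ereal (1/36 * (real N powr (1/9) / ln (real N))) \<le> ereal_of_enat (sign_rank {1..N} ?F)"
    by (rule sign_rank_geI)
  moreover have "?F \<subseteq> {1..N} \<rightarrow>\<^sub>E {1, -1}"
    by (auto simp: partial_line_class_def sign_fun_def)
  ultimately show "\<exists>F. F \<subseteq> ({1..N} \<rightarrow>\<^sub>E {1, -1}) \<and> (\<lambda>x\<in>{1..N}. 1) \<in> F \<and>
      Edim {1..N} F (\<lambda>x\<in>{1..N}. 1) = 4 \<and>
      ereal_of_enat (sign_rank {1..N} F) \<ge> ereal (1/36 * (real N powr (1/9) / ln (real N)))"
    using one Edim_partial_line_class[OF N T(1)] by (intro exI[of _ ?F] conjI)
qed simp

end
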